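(* Let $m \geq 2$ be an integer and let $a \in (0,1)$ be real. Then $$\sum_{n=1}^{\infty}\frac{a^{2n}\zeta(2n)}{n}\binom{2n}{m}=\frac{a^m}{m}\Big((-1)^m\zeta(m; a)+\zeta(m; 1-a)\Big)+\frac{(-1)^{m-1}}{m}.$$
   Context: $\zeta(s)=\sum_{n=1}^{\infty} n^{-s}$ denotes the Riemann zeta function, and for $\operatorname{Re} s>1$ and $0<a\leq 1$, $\zeta(s;a)=\sum_{n=0}^{\infty}(n+a)^{-s}$ denotes the Hurwitz zeta function. The binomial coefficient $\binom{2n}{m}$ is $0$ when $2n<m$. *)

theory Defs
  imports "HOL-Analysis.Analysis"
begin

(* Both functions are given by their series, so their values are meaningful only
   for Re s > 1 (and, for hurwitz_zeta, a > 0); no analytic continuation is built in. *)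

definition zeta :: "complex \<Rightarrow> complex" where
  "zeta s = (\<Sum>n. of_nat (Suc n) powr (- s))"

definition hurwitz_zeta :: "complex \<Rightarrow> real \<Rightarrow> complex" where
  "hurwitz_zeta s a = (\<Sum>n. of_real (real n + a) powr (- s))"

end

theory Submission
  imports Defs
begin

text \<open>
  Expand \<open>\<zeta>(2n) = \<Sum>\<^sub>j j\<^sup>-\<^sup>2\<^sup>n\<close> and interchange the two summations, which is allowed because all terms
  are nonnegative. Since \<open>(2n choose m) / n = (2/m) (2n-1 choose m-1)\<close>, the sum over \<open>n\<close> at
  \<open>x = a/j\<close> is \<open>2/m\<close> times the even part of \<open>\<Sum>\<^sub>N (N-1 choose m-1) x\<^sup>N = (x/(1-x))\<^sup>m\<close>, and
  \<open>x/(1-x) = a/(j-a)\<close>. Summing over \<open>j \<ge> 1\<close> gives the two Hurwitz zeta values, except that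
  \<open>\<zeta>(m; a)\<close> has an additional term \<open>a\<^sup>-\<^sup>m\<close> at \<open>j = 0\<close>.
\<close>

text \<open>Tonelli for series: nonnegativity upgrades each \<open>sums\<close> to an unconditional
  \<open>has_sum\<close>, and summable row sums then make the whole double family summable, so it
  may also be summed by columns.\<close>

lemma sums_swap_nonneg:
  fixes f :: "nat \<Rightarrow> nat \<Rightarrow> real"
  assumes nonneg: "\<And>j k. f j k \<ge> 0"
    and rows: "\<And>j. f j sums g j" and total: "g sums S"
    and columns: "\<And>k. (\<lambda>j. f j k) sums c k"
  shows "c sums S"
proof -
  have rows': "((\<lambda>k. case (j, k) of (j, k) \<Rightarrow> f j k) has_sum g j) UNIV" for j
    using sums_nonneg_imp_has_sum[OF rows nonneg] by simp
  have g_nonneg: "g j \<ge> 0" for j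
    using sums_le[OF nonneg sums_zero rows] .
  have g: "(g has_sum S) UNIV"
    using sums_nonneg_imp_has_sum[OF total g_nonneg] .
  have "(\<lambda>(j, k). f j k) summable_on UNIV \<times> UNIV"
    by (rule summable_on_SigmaI[OF rows' has_sum_imp_summable[OF g]]) (use nonneg in auto)
  then have "((\<lambda>(j, k). f j k) has_sum S) (UNIV \<times> UNIV)"
    by (intro has_sum_SigmaI[OF rows' g])
  then have "((\<lambda>(k, j). f j k) has_sum S) (UNIV \<times> UNIV)"
    using has_sum_swap[of "\<lambda>(j, k). f j k" UNIV UNIV S] by simp
  moreover have "((\<lambda>j. case (k, j) of (k, j) \<Rightarrow> f j k) has_sum c k) UNIV" for k
    using sums_nonneg_imp_has_sum[OF columns nonneg] by simp
  ultimately have "(c has_sum S) UNIV"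
    by (rule has_sum_SigmaD)
  then show ?thesis
    by (rule has_sum_imp_sums)
qed

text \<open>This is the binomial series of \<open>(1 - x)\<close> to the power
  \<open>- (r + 1)\<close>, multiplied by \<open>x ^ Suc r\<close>.\<close>

lemma negative_binomial_sums:
  fixes x :: real
  assumes "\<bar>x\<bar> < 1"
  shows "(\<lambda>i. real (i choose r) * x ^ Suc i) sums (x / (1 - x)) ^ Suc r"
proof -
  have "(\<lambda>n. ((- real (Suc r)) gchoose n) * (- x) ^ n) sums (1 + - x) powr (- real (Suc r))"
    by (rule gen_binomial_real) (use assms in simp)
  moreover have "((- real (Suc r)) gchoose n) * (- x) ^ n = real ((n + r) choose r) * x ^ n" for n
  proof -
    \<comment> \<open>Negating the upper index produces a factor \<open>(-1) ^ n\<close>, which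
      cancels the sign of \<open>(- x) ^ n\<close>.\<close>
    have "((- real (Suc r)) gchoose n) * (- x) ^ n
        = ((-1) ^ n * (-1) ^ n) * (real (n + r) gchoose n) * x ^ n"
      unfolding gbinomial_minus[of "real (Suc r)"] power_minus[of x] by (simp add: add_ac)
    also have "real (n + r) gchoose n = real ((n + r) choose r)"
      using binomial_symmetric[of n "n + r"] unfolding binomial_gbinomial[symmetric] by simp
    finally show ?thesis
      by (simp flip: power_mult_distrib)
  qed
  moreover have "(1 + - x) powr (- real (Suc r)) = 1 / (1 - x) ^ Suc r"
    using assms by (subst powr_minus, subst powr_realpow) (auto simp: field_simps)
  ultimately have "(\<lambda>n. real ((n + r) choose r) * x ^ n) sums (1 / (1 - x) ^ Suc r)"
    by simp
  from sums_mult[OF this, of "x ^ Suc r"]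
  have "(\<lambda>n. real ((n + r) choose r) * x ^ Suc (n + r)) sums (x / (1 - x)) ^ Suc r"
    by (simp add: power_divide power_add mult_ac)
  \<comment> \<open>The terms with \<open>i < r\<close> vanish because
    \<open>i choose r = 0\<close>, so the index may start at 0.\<close>
  then show ?thesis
    using sums_zero_iff_shift[of r "\<lambda>i. real (i choose r) * x ^ Suc i"] by simp
qed

text \<open>Adding the series at \<open>x\<close> and at \<open>- x\<close> doubles the even powers
  and cancels the odd ones. The exponent \<open>Suc i\<close> is even exactly when
  \<open>i = Suc (2 * k)\<close>.\<close>

lemma even_negative_binomial_sums:
  fixes x :: real
  assumes "\<bar>x\<bar> < 1"
  shows "(\<lambda>k. 2 * real (Suc (2 * k) choose r) * x ^ (2 * Suc k)) sums
    ((x / (1 - x)) ^ Suc r + (- x / (1 + x)) ^ Suc r)"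
proof -
  define f where "f i = real (i choose r) * x ^ Suc i + real (i choose r) * (- x) ^ Suc i" for i
  have "f sums ((x / (1 - x)) ^ Suc r + (- x / (1 + x)) ^ Suc r)"
    unfolding f_def
    using sums_add[OF negative_binomial_sums[of x r] negative_binomial_sums[of "- x" r]] assms
    by simp
  moreover have "f i = 0" if "i \<notin> range (\<lambda>k. Suc (2 * k))" for i
  proof -
    have "even i"
      using that by (metis oddE rangeI Suc_eq_plus1)
    then show ?thesis
      by (simp add: f_def)
  qed
  ultimately have "(\<lambda>k. f (Suc (2 * k))) sums ((x / (1 - x)) ^ Suc r + (- x / (1 + x)) ^ Suc r)"
    by (subst sums_mono_reindex) (auto simp: strict_mono_def)
  then show ?thesis
    by (simp add: f_def mult_ac)
qed

lemma summable_hurwitz: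
  assumes "m \<ge> 2" "b > 0"
  shows "summable (\<lambda>n. 1 / (real n + b) ^ m)"
proof -
  \<comment> \<open>Without the term at 0, the series is dominated by that of
    \<open>1 / (n + 1) ^ m\<close>.\<close>
  have "summable (\<lambda>n. 1 / (real (Suc n) + b) ^ m)"
  proof (rule summable_comparison_test')
    show "summable (\<lambda>n. inverse (real (Suc n) ^ m))"
      using inverse_power_summable[OF assms(1), where 'a = real]
        summable_Suc_iff[of "\<lambda>n. inverse (real n ^ m)"] by simp
    show "norm (1 / (real (Suc n) + b) ^ m) \<le> inverse (real (Suc n) ^ m)" for n
      using assms by (auto simp: divide_inverse intro!: le_imp_inverse_le power_mono)
  qed
  then show ?thesis
    using summable_Suc_iff[of "\<lambda>n. 1 / (real n + b) ^ m"] by simp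
qed

lemma hurwitz_zeta_of_nat:
  assumes "m \<ge> 2" "b > 0"
  shows "hurwitz_zeta (of_nat m) b = of_real (\<Sum>n. 1 / (real n + b) ^ m)"
proof -
  have "of_real (real n + b) powr (- of_nat m) = complex_of_real (1 / (real n + b) ^ m)" for n
  proof -
    have "complex_of_real (real n + b) \<noteq> 0"
      using assms(2) by (simp only: of_real_eq_0_iff)
    then have "complex_of_real (real n + b) powr of_nat m = complex_of_real (real n + b) ^ m"
      by (intro powr_nat' disjI1)
    then show ?thesis
      by (simp only: powr_minus divide_inverse mult_1_left of_real_inverse of_real_1 of_real_power)
  qed
  then show ?thesis
    unfolding hurwitz_zeta_def by (simp only: suminf_of_real[OF summable_hurwitz[OF assms]])
qed

lemma zeta_eq_hurwitz_zeta: "zeta s = hurwitz_zeta s 1"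
  by (simp add: zeta_def hurwitz_zeta_def add_ac)

theorem theorem1p1:
  fixes m :: nat and a :: real
  assumes "m \<ge> 2" and "a \<in> {0<..<1}"
  shows "(\<lambda>k. let n = Suc k in
            complex_of_real a ^ (2 * n) * zeta (of_nat (2 * n)) / of_nat n * of_nat ((2 * n) choose m))
         sums
         (complex_of_real a ^ m / of_nat m *
            ((- 1) ^ m * hurwitz_zeta (of_nat m) a + hurwitz_zeta (of_nat m) (1 - a))
          + (- 1) ^ (m - 1) / of_nat m)"
proof -
  \<comment> \<open>\<open>H\<close> is the real-valued Hurwitz series: the interchange needs
    nonnegative reals, and the result is carried over to the complex numbers only at the
    end.\<close>
  define H where "H b p = (\<Sum>n. 1 / (real n + b) ^ p)" for b :: real and p :: nat
  have H: "(\<lambda>n. 1 / (real n + b) ^ p) sums H b p" if "p \<ge> 2" "b > 0" for b p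
    unfolding H_def using summable_hurwitz[OF that] by (rule summable_sums)
  obtain r where r: "m = Suc r"
    using assms(1) by (cases m) auto
  have a: "0 < a" "a < 1"
    using assms(2) by auto
  \<comment> \<open>The double family, with \<open>Suc j\<close> as the index of the \<zeta> series
    and \<open>Suc k\<close> as n; \<open>g\<close> holds its row sums and \<open>c\<close> its
    column sums.\<close>
  define f where "f j k = (a / real (Suc j)) ^ (2 * Suc k) / real (Suc k) * real ((2 * Suc k) choose m)"
    for j k
  define g where "g j = a ^ m / m * ((- 1) ^ m * (1 / (real (Suc j) + a) ^ m) + 1 / (real j + (1 - a)) ^ m)"
    for j
  define c where "c k = a ^ (2 * Suc k) * H 1 (2 * Suc k) / real (Suc k) * real ((2 * Suc k) choose m)"
    for k
  define S where "S = a ^ m / m * ((- 1) ^ m * (H a m - 1 / a ^ m) + H (1 - a) m)"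
  have "c sums S"
  proof (rule sums_swap_nonneg)
    show "f j k \<ge> 0" for j k
      using a by (simp add: f_def)
    show "f j sums g j" for j
    proof -
      define x where "x = a / real (Suc j)"
      have x: "\<bar>x\<bar> < 1"
        using a by (simp add: x_def)
      \<comment> \<open>Since \<open>j\<close> starts at 0, the first denominator runs through the
        whole Hurwitz series at \<open>1 - a\<close>, while the second runs through the one at
        \<open>a\<close> from its second term on.\<close>
      have "1 - x = (real j + (1 - a)) / real (Suc j)" "1 + x = (real (Suc j) + a) / real (Suc j)"
        by (simp_all add: x_def field_simps)
      then have quotients: "x / (1 - x) = a / (real j + (1 - a))" "- x / (1 + x) = - a / (real (Suc j) + a)"
        by (simp_all add: x_def del: of_nat_Suc)
      have "1 / m * ((x / (1 - x)) ^ Suc r + (- x / (1 + x)) ^ Suc r) = g j"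
        by (simp only: quotients g_def r[symmetric] power_divide power_minus[of a]) (simp add: algebra_simps)
      moreover have "1 / m * (2 * real (Suc (2 * k) choose r) * x ^ (2 * Suc k)) = f j k" for k
      proof -
        \<comment> \<open>Absorption identity for binomial coefficients, with upper index 2n for n =
          \<open>Suc k\<close> and with \<open>r = m - 1\<close>.\<close>
        have "real m * real (2 * Suc k choose m) = 2 * real (Suc k) * real (Suc (2 * k) choose r)"
          using arg_cong[OF Suc_times_binomial[of r "Suc (2 * k)"], of real] unfolding r of_nat_mult
          by simp
        moreover have "1 / M * (2 * Q * y) = y / K * P"
          if "M * P = 2 * K * Q" "M \<noteq> 0" "K \<noteq> 0" for K M P Q y :: real
        proof -
          have "P = 2 * K * Q / M"
            using that by (simp add: field_simps)
          then show ?thesis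
            using that by simp
        qed
        ultimately show ?thesis
          unfolding f_def x_def[symmetric] using r by simp
      qed
      ultimately show ?thesis
        using sums_mult[OF even_negative_binomial_sums[OF x, of r], of "1 / m"] by simp
    qed
    have "(\<lambda>j. 1 / (real (Suc j) + a) ^ m) sums (H a m - 1 / a ^ m)"
      using H[OF assms(1) a(1)] sums_Suc_iff[of "\<lambda>j. 1 / (real j + a) ^ m"] by simp
    moreover have "(\<lambda>j. 1 / (real j + (1 - a)) ^ m) sums H (1 - a) m"
      using H[OF assms(1)] a by simp
    ultimately show "g sums S"
      unfolding g_def S_def by (intro sums_mult sums_add)
    \<comment> \<open>What depends on \<open>j\<close> is only
      \<open>1 / (j + 1) ^ (2 * Suc k)\<close>, whose sum is the Hurwitz series at 1, that is,
      \<zeta>(2n).\<close>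
    show "(\<lambda>j. f j k) sums c k" for k
      using sums_mult[OF H[of "2 * Suc k" 1], of "a ^ (2 * Suc k) / real (Suc k) * real ((2 * Suc k) choose m)"]
      by (simp add: f_def c_def power_divide add_ac mult_ac del: power_Suc)
  qed
  then have "(\<lambda>k. complex_of_real (c k)) sums complex_of_real S"
    by (simp only: sums_of_real_iff)
  moreover have "complex_of_real (c k) =
      (let n = Suc k in complex_of_real a ^ (2 * n) * zeta (of_nat (2 * n)) / of_nat n * of_nat ((2 * n) choose m))" for k
    using hurwitz_zeta_of_nat[of "2 * Suc k" 1]
    by (simp add: c_def Let_def zeta_eq_hurwitz_zeta H_def del: power_Suc of_nat_Suc of_nat_mult mult_Suc_right binomial_Suc_Suc)
  moreover have "complex_of_real S = complex_of_real a ^ m / of_nat m *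
      ((- 1) ^ m * hurwitz_zeta (of_nat m) a + hurwitz_zeta (of_nat m) (1 - a)) + (- 1) ^ (m - 1) / of_nat m"
  proof -
    \<comment> \<open>The removed term contributes \<open>- (- 1) ^ m / m\<close> once
      \<open>a ^ m\<close> cancels; this sign change turns it into the last summand of the
      claim.\<close>
    have "(- 1) ^ m = - ((- 1) ^ (m - 1) :: real)" "a ^ m \<noteq> 0"
      using a by (simp_all add: r)
    then have "S = a ^ m / m * ((- 1) ^ m * H a m + H (1 - a) m) + (- 1) ^ (m - 1) / m"
      by (simp add: S_def algebra_simps)
    then show ?thesis
      using a by (simp add: H_def hurwitz_zeta_of_nat assms(1))
  qed
  ultimately show ?thesis
    by simp
qed

end
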